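(* Let $(\varphi_n)_{n\in\mathbb N}$ be a sequence of Young functions such that $\varphi_{j+1}(t)\le \varphi_j(t)$ and $\sum_{n=1}^\infty \varphi_n(t)=+\infty$ for each $t>0$ and $j\in\mathbb N$. Let $k\colon[0,1]\times[0,1]\to\mathbb R$ be a kernel such that for every $t\in[0,1]$ the function $s\mapsto k(t,s)$ is Lebesgue integrable on $[0,1]$, and let $K$ be the linear integral operator given by $$(Kx)(t)=\int_0^1 k(t,s)x(s)\,ds,\qquad t\in[0,1],\ x\in BV[0,1]$$ (Lebesgue integral). Then $K$ maps $BV[0,1]$ into $\Phi BV[0,1]$ and is continuous (with respect to $\|\cdot\|_{BV}$ and $\|\cdot\|_\Phi$) if and only if there exists a constant $\mu>0$ such that for every $\xi\in[0,1]$ $$\operatorname{var}_\Phi\Bigl(\mu\cdot\int_0^\xi k(\cdot,s)\,ds\Bigr)\le 1,$$ where $\int_0^\xi k(\cdot,s)\,ds$ denotes the function $t\mapsto\int_0^\xi k(t,s)\,ds$ on $[0,1]$.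
   Context: A Young function is a convex function $\varphi\colon[0,+\infty)\to[0,+\infty)$ such that $\varphi(t)=0$ if and only if $t=0$. Closed intervals may be degenerate (a single point). Two intervals are non-overlapping if their intersection is empty or a singleton; a collection is non-overlapping if its members are pairwise so, and the intervals in a collection are assumed distinct. For a function $x$ and an interval $I=[a,b]$ write $x(I):=x(b)-x(a)$. For a sequence $(\varphi_n)$ of Young functions with $\varphi_{j+1}\le\varphi_j$ and $\sum_n\varphi_n(t)=+\infty$ for $t>0$, the Schramm variation of $x\colon[0,1]\to\mathbb R$ is $$\operatorname{var}_\Phi x:=\sup\sum_{n=1}^{m}\varphi_n(|x(I_n)|)\in[0,+\infty],$$ where the supremum is over all finite collections $I_1,\dots,I_m$ ($m\in\mathbb N$, in any order) of closed non-overlapping subintervals of $[0,1]$. The Jordan variation $\operatorname{var}x$ is the case $\varphi_n(t)=t$ for all $n$. $\Phi BV[0,1]$ is the linear space of all $x\colon[0,1]\to\mathbb R$ such that $\operatorname{var}_\Phi(\lambda x)<+\infty$ for some $\lambda>0$; it is a Banach space with norm $\|x\|_\Phi:=|x(0)|+|x|_\Phi$, where $|x|_\Phi:=\inf\{\lambda>0 : \operatorname{var}_\Phi(\lambda^{-1}x)\le1\}$. $BV[0,1]$ is the linear space of all $x\colon[0,1]\to\mathbb R$ with $\operatorname{var}x<+\infty$, a Banach space with norm $\|x\|_{BV}:=|x(0)|+\operatorname{var}x$. *)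

theory Defs
  imports "HOL-Analysis.Analysis"
begin

text \<open>
  Functions on $[0,1]$ are rendered as total functions \<^typ>\<open>real \<Rightarrow> real\<close>; every notion below
  inspects their values on $[0,1]$ only. Likewise Young functions are inspected on $[0,\infty)$ only.
  Sequences of Young functions are indexed from 0.
\<close>

definition young_function :: "(real \<Rightarrow> real) \<Rightarrow> bool" where
  "young_function \<phi> \<longleftrightarrow>
     convex_on {0..} \<phi> \<and> (\<forall>t\<ge>0. 0 \<le> \<phi> t) \<and> (\<forall>t\<ge>0. \<phi> t = 0 \<longleftrightarrow> t = 0)"

text \<open>A closed interval $[a,b]$ with $a \le b$, possibly degenerate, is encoded as the pair $(a,b)$.\<close>

definition nonoverlapping :: "real \<times> real \<Rightarrow> real \<times> real \<Rightarrow> bool" where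
  "nonoverlapping I J \<longleftrightarrow>
     {fst I..snd I} \<inter> {fst J..snd J} = {} \<or> is_singleton ({fst I..snd I} \<inter> {fst J..snd J})"

definition nonoverlapping_lists :: "(real \<times> real) list set" where
  "nonoverlapping_lists =
     {Is. (\<forall>(a, b) \<in> set Is. 0 \<le> a \<and> a \<le> b \<and> b \<le> 1) \<and> distinct Is \<and>
          pairwise nonoverlapping (set Is)}"

text \<open>
  The supremum ranges over lists, so all orderings of a collection are included.
  The empty list contributes the value 0 only.
\<close>

definition schramm_var :: "(nat \<Rightarrow> real \<Rightarrow> real) \<Rightarrow> (real \<Rightarrow> real) \<Rightarrow> ennreal" where
  "schramm_var \<phi> x =
     (SUP Is \<in> nonoverlapping_lists.
        \<Sum>n<length Is. ennreal (\<phi> n \<bar>x (snd (Is ! n)) - x (fst (Is ! n))\<bar>))"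

definition jordan_var :: "(real \<Rightarrow> real) \<Rightarrow> ennreal" where
  "jordan_var x = schramm_var (\<lambda>n t. t) x"

definition BV :: "(real \<Rightarrow> real) set" where
  "BV = {x. jordan_var x < \<infinity>}"

definition norm_BV :: "(real \<Rightarrow> real) \<Rightarrow> real" where
  "norm_BV x = \<bar>x 0\<bar> + enn2real (jordan_var x)"

definition PhiBV :: "(nat \<Rightarrow> real \<Rightarrow> real) \<Rightarrow> (real \<Rightarrow> real) set" where
  "PhiBV \<phi> = {x. \<exists>c>0. schramm_var \<phi> (\<lambda>t. c * x t) < \<infinity>}"

definition seminorm_Phi :: "(nat \<Rightarrow> real \<Rightarrow> real) \<Rightarrow> (real \<Rightarrow> real) \<Rightarrow> real" where
  "seminorm_Phi \<phi> x = Inf {c. c > 0 \<and> schramm_var \<phi> (\<lambda>t. inverse c * x t) \<le> 1}"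

definition norm_Phi :: "(nat \<Rightarrow> real \<Rightarrow> real) \<Rightarrow> (real \<Rightarrow> real) \<Rightarrow> real" where
  "norm_Phi \<phi> x = \<bar>x 0\<bar> + seminorm_Phi \<phi> x"

definition integral_operator :: "(real \<Rightarrow> real \<Rightarrow> real) \<Rightarrow> (real \<Rightarrow> real) \<Rightarrow> real \<Rightarrow> real" where
  "integral_operator k x t = (LINT s:{0..1}|lebesgue. k t s * x s)"

text \<open>
  Continuity of an operator on a set \<open>X\<close> of functions, for the distances induced by the
  norms \<open>N\<close> on the domain and \<open>M\<close> on the codomain.
\<close>

definition norm_continuous_on ::
  "(real \<Rightarrow> real) set \<Rightarrow> ((real \<Rightarrow> real) \<Rightarrow> real) \<Rightarrow> ((real \<Rightarrow> real) \<Rightarrow> real) \<Rightarrow>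
   ((real \<Rightarrow> real) \<Rightarrow> real \<Rightarrow> real) \<Rightarrow> bool" where
  "norm_continuous_on X N M T \<longleftrightarrow>
     (\<forall>x\<in>X. \<forall>\<epsilon>>0. \<exists>\<delta>>0. \<forall>y\<in>X.
        N (\<lambda>t. y t - x t) < \<delta> \<longrightarrow> M (\<lambda>t. T y t - T x t) < \<epsilon>)"

end

theory Submission
  imports Defs
begin

text \<open>
  Write \<open>K\<^sub>\<xi>\<close> for the function \<open>t \<mapsto> \<integral>\<^sub>0\<^sup>\<xi> k(t,s) ds\<close>, the image of the indicator of \<open>[0,\<xi>]\<close>.
  These indicators have bounded norm in \<open>BV\<close>, so continuity at 0 bounds
  the functions \<open>K\<^sub>\<xi>\<close> uniformly. Conversely, Abel summation shows that a
  step function sampling \<open>x\<close> is a combination of such indicators whose coefficients have absolute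
  sum at most \<open>2 \<parallel>x\<parallel>\<close>. The unit ball of the Schramm variation is absolutely convex
  and closed under pointwise limits, and \<open>Kx\<close> is the pointwise limit of the images of the
  step functions by dominated convergence, since \<open>x\<close> has only countably many discontinuities.
\<close>

section \<open>Young functions\<close>

lemma young_mono:
  assumes "young_function \<phi>" "0 \<le> s" "s \<le> t"
  shows "\<phi> s \<le> \<phi> t"
proof (cases "t = 0")
  case False
  then have t: "t > 0" using assms by simp
  have c: "convex_on {0..} \<phi>" and z: "\<phi> 0 = 0" and p: "0 \<le> \<phi> t"
    using assms t by (auto simp: young_function_def)
  have "\<phi> ((1 - s/t) *\<^sub>R 0 + (s/t) *\<^sub>R t) \<le> (1 - s/t) * \<phi> 0 + (s/t) * \<phi> t"
    by (rule convex_onD[OF c]) (use assms t in auto)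
  then have "\<phi> s \<le> (s/t) * \<phi> t" using t z by simp
  also have "\<dots> \<le> 1 * \<phi> t" by (rule mult_right_mono) (use assms t p in auto)
  finally show ?thesis by simp
qed (use assms in auto)

lemma young_nonneg: "young_function \<phi> \<Longrightarrow> 0 \<le> t \<Longrightarrow> 0 \<le> \<phi> t"
  by (auto simp: young_function_def)

lemma young_zero: "young_function \<phi> \<Longrightarrow> \<phi> 0 = 0"
  by (auto simp: young_function_def)

text \<open>Monotonicity of \<open>\<phi>\<close> transfers the convexity of the absolute value. The
  even extension lives on all of the real line, an open set, which is what the continuity argument
  asks for.\<close>

lemma young_abs_convex:
  assumes "young_function \<phi>"
  shows "convex_on UNIV (\<lambda>t. \<phi> \<bar>t\<bar>)"
proof (rule convex_onI)
  fix u x y :: real assume u: "0 < u" "u < 1"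
  have c: "convex_on {0..} \<phi>" using assms by (auto simp: young_function_def)
  have "\<bar>(1 - u) * x + u * y\<bar> \<le> \<bar>(1 - u) * x\<bar> + \<bar>u * y\<bar>"
    by (rule abs_triangle_ineq)
  also have "\<dots> = (1 - u) * \<bar>x\<bar> + u * \<bar>y\<bar>"
    using u by (simp add: abs_mult)
  finally have "\<phi> \<bar>(1 - u) *\<^sub>R x + u *\<^sub>R y\<bar> \<le> \<phi> ((1 - u) *\<^sub>R \<bar>x\<bar> + u *\<^sub>R \<bar>y\<bar>)"
    by (intro young_mono[OF assms]) auto
  also have "\<dots> \<le> (1 - u) * \<phi> \<bar>x\<bar> + u * \<phi> \<bar>y\<bar>"
    by (rule convex_onD[OF c]) (use u in auto)
  finally show "\<phi> \<bar>(1 - u) *\<^sub>R x + u *\<^sub>R y\<bar> \<le> (1 - u) * \<phi> \<bar>x\<bar> + u * \<phi> \<bar>y\<bar>" .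
qed simp

text \<open>Convex functions are continuous on open sets. Passing through the even extension makes 0
  an interior point; convexity on the closed half-line says nothing directly about continuity
  there.\<close>

lemma young_abs_continuous:
  assumes "young_function \<phi>"
  shows "isCont (\<lambda>t. \<phi> \<bar>t\<bar>) t"
  using convex_on_continuous[OF open_UNIV young_abs_convex[OF assms]]
  by (simp add: continuous_on_eq_continuous_at)

lemma young_scale:
  assumes "young_function \<phi>" "0 \<le> c" "c \<le> 1" "0 \<le> t"
  shows "\<phi> (c * t) \<le> c * \<phi> t"
proof -
  have "\<phi> ((1 - c) *\<^sub>R 0 + c *\<^sub>R t) \<le> (1 - c) * \<phi> 0 + c * \<phi> t"
    by (rule convex_onD[where A="{0..}"]) (use assms in \<open>auto simp: young_function_def\<close>)
  then show ?thesis by (simp add: young_zero[OF assms(1)])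
qed

text \<open>Jensen's inequality for absolutely convex combinations. The weights are normalised by
  their absolute sum \<open>W\<close>, and \<open>young_scale\<close> pulls the factor
  \<open>W \<le> 1\<close> out of \<open>\<phi>\<close>.\<close>

lemma young_abs_sum:
  fixes w y :: "'i \<Rightarrow> real"
  assumes young: "young_function \<phi>" and fin: "finite S" and w: "(\<Sum>i\<in>S. \<bar>w i\<bar>) \<le> 1"
  shows "\<phi> \<bar>\<Sum>i\<in>S. w i * y i\<bar> \<le> (\<Sum>i\<in>S. \<bar>w i\<bar> * \<phi> \<bar>y i\<bar>)"
proof -
  define W where "W = (\<Sum>i\<in>S. \<bar>w i\<bar>)"
  have W0: "0 \<le> W" unfolding W_def by (simp add: sum_nonneg)
  show ?thesis
  proof (cases "W = 0")
    case True
    then have "\<And>i. i \<in> S \<Longrightarrow> w i = 0"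
      using fin by (simp add: W_def sum_nonneg_eq_0_iff)
    then show ?thesis by (simp add: young_zero[OF young])
  next
    case False
    then have W: "W > 0" using W0 by linarith
    have ne: "S \<noteq> {}" using False by (auto simp: W_def)
    have c: "convex_on {0..} \<phi>" using young by (auto simp: young_function_def)
    \<comment> \<open>Used twice: with the values \<open>\<bar>y i\<bar>\<close> before Jensen's
      inequality to introduce the normalised weights, and with \<open>\<phi> \<bar>y i\<bar>\<close>
      after it to remove them.\<close>
    have eq: "W * (\<Sum>i\<in>S. (\<bar>w i\<bar> / W) * z i) = (\<Sum>i\<in>S. \<bar>w i\<bar> * z i)" for z :: "'i \<Rightarrow> real"
      using W by (simp add: sum_distrib_left)
    have "\<bar>\<Sum>i\<in>S. w i * y i\<bar> \<le> (\<Sum>i\<in>S. \<bar>w i\<bar> * \<bar>y i\<bar>)"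
      by (rule order_trans[OF sum_abs]) (simp add: abs_mult)
    then have "\<phi> \<bar>\<Sum>i\<in>S. w i * y i\<bar> \<le> \<phi> (W * (\<Sum>i\<in>S. (\<bar>w i\<bar> / W) * \<bar>y i\<bar>))"
      unfolding eq by (intro young_mono[OF young]) auto
    also have "\<dots> \<le> W * \<phi> (\<Sum>i\<in>S. (\<bar>w i\<bar> / W) * \<bar>y i\<bar>)"
      using W w by (intro young_scale[OF young]) (auto simp: W_def intro!: sum_nonneg)
    also have "\<dots> \<le> W * (\<Sum>i\<in>S. (\<bar>w i\<bar> / W) * \<phi> \<bar>y i\<bar>)"
    proof (rule mult_left_mono)
      have "\<phi> (\<Sum>i\<in>S. (\<bar>w i\<bar> / W) *\<^sub>R \<bar>y i\<bar>) \<le> (\<Sum>i\<in>S. (\<bar>w i\<bar> / W) * \<phi> \<bar>y i\<bar>)"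
        by (rule convex_on_sum[OF fin ne c])
          (use W in \<open>auto simp: W_def simp flip: sum_divide_distrib\<close>)
      then show "\<phi> (\<Sum>i\<in>S. (\<bar>w i\<bar> / W) * \<bar>y i\<bar>) \<le> (\<Sum>i\<in>S. (\<bar>w i\<bar> / W) * \<phi> \<bar>y i\<bar>)"
        by simp
    qed (use W in auto)
    finally show ?thesis unfolding eq .
  qed
qed

section \<open>Schramm variation\<close>

text \<open>The sum for a single list, taken in the reals, so that estimates avoid
  \<open>ennreal\<close> arithmetic.\<close>

definition variation_sum ::
  "(nat \<Rightarrow> real \<Rightarrow> real) \<Rightarrow> (real \<Rightarrow> real) \<Rightarrow> (real \<times> real) list \<Rightarrow> real" where
  "variation_sum \<phi> x Is = (\<Sum>n<length Is. \<phi> n \<bar>x (snd (Is ! n)) - x (fst (Is ! n))\<bar>)"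

lemma nonoverlapping_lists_nth:
  assumes "Is \<in> nonoverlapping_lists" "n < length Is"
  shows "0 \<le> fst (Is ! n)" "fst (Is ! n) \<le> snd (Is ! n)" "snd (Is ! n) \<le> 1"
proof -
  have "Is ! n \<in> set Is" using assms by simp
  moreover have "\<forall>(a, b) \<in> set Is. 0 \<le> a \<and> a \<le> b \<and> b \<le> 1"
    using assms by (simp add: nonoverlapping_lists_def)
  ultimately show "0 \<le> fst (Is ! n)" "fst (Is ! n) \<le> snd (Is ! n)" "snd (Is ! n) \<le> 1"
    by fastforce+
qed

text \<open>Nonnegativity of the summands and of \<open>C\<close> means that the embedding into
  \<open>ennreal\<close> loses nothing, so a bound on the supremum becomes a family of real
  inequalities.\<close>

lemma schramm_var_le_iff:
  assumes "\<And>n t. 0 \<le> t \<Longrightarrow> 0 \<le> \<phi> n t" "0 \<le> C"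
  shows "schramm_var \<phi> x \<le> ennreal C \<longleftrightarrow> (\<forall>Is\<in>nonoverlapping_lists. variation_sum \<phi> x Is \<le> C)"
  unfolding schramm_var_def variation_sum_def SUP_le_iff
  using assms by (simp add: ennreal_le_iff)

lemma schramm_var_le_1_iff:
  assumes "\<And>n. young_function (\<phi> n)"
  shows "schramm_var \<phi> x \<le> 1 \<longleftrightarrow> (\<forall>Is\<in>nonoverlapping_lists. variation_sum \<phi> x Is \<le> 1)"
  using schramm_var_le_iff[of \<phi> 1 x] assms by (simp add: young_nonneg)

text \<open>Only endpoints in \<open>[0,1]\<close> are evaluated. This matters because identities
  for the kernel are available for \<open>t\<close> in \<open>[0,1]\<close> only.\<close>

lemma schramm_var_cong:
  assumes "\<And>t. t \<in> {0..1} \<Longrightarrow> x t = y t"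
  shows "schramm_var \<phi> x = schramm_var \<phi> y"
  unfolding schramm_var_def
proof (intro SUP_cong refl sum.cong)
  fix Is n assume Is: "Is \<in> nonoverlapping_lists" and "n \<in> {..<length Is}"
  with nonoverlapping_lists_nth[OF Is, of n]
  have "fst (Is ! n) \<in> {0..1}" "snd (Is ! n) \<in> {0..1}" by auto
  then show "ennreal (\<phi> n \<bar>x (snd (Is ! n)) - x (fst (Is ! n))\<bar>)
      = ennreal (\<phi> n \<bar>y (snd (Is ! n)) - y (fst (Is ! n))\<bar>)"
    by (simp add: assms)
qed

lemma norm_Phi_cong:
  assumes "\<And>t. t \<in> {0..1} \<Longrightarrow> x t = y t"
  shows "norm_Phi \<phi> x = norm_Phi \<phi> y"
proof -
  have "schramm_var \<phi> (\<lambda>t. c * x t) = schramm_var \<phi> (\<lambda>t. c * y t)" for c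
    by (rule schramm_var_cong) (simp add: assms)
  then show ?thesis
    using assms[of 0] by (simp add: norm_Phi_def seminorm_Phi_def)
qed

text \<open>Absolute convexity of the unit ball: Jensen's inequality is applied to the increment
  over each interval, and the two finite sums are then exchanged.\<close>

lemma schramm_var_combination:
  fixes w :: "'i \<Rightarrow> real"
  assumes young: "\<And>n. young_function (\<phi> n)" and fin: "finite S"
    and w: "(\<Sum>i\<in>S. \<bar>w i\<bar>) \<le> 1" and f: "\<And>i. i \<in> S \<Longrightarrow> schramm_var \<phi> (f i) \<le> 1"
  shows "schramm_var \<phi> (\<lambda>t. \<Sum>i\<in>S. w i * f i t) \<le> 1"
  unfolding schramm_var_le_1_iff[OF young]
proof
  fix Is assume Is: "Is \<in> nonoverlapping_lists"
  have "variation_sum \<phi> (\<lambda>t. \<Sum>i\<in>S. w i * f i t) Is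
      = (\<Sum>n<length Is. \<phi> n \<bar>\<Sum>i\<in>S. w i * (f i (snd (Is ! n)) - f i (fst (Is ! n)))\<bar>)"
    by (simp add: variation_sum_def right_diff_distrib sum_subtractf)
  also have "\<dots> \<le> (\<Sum>n<length Is. \<Sum>i\<in>S. \<bar>w i\<bar> * \<phi> n \<bar>f i (snd (Is ! n)) - f i (fst (Is ! n))\<bar>)"
    by (intro sum_mono young_abs_sum[OF young fin w])
  also have "\<dots> = (\<Sum>i\<in>S. \<bar>w i\<bar> * variation_sum \<phi> (f i) Is)"
    unfolding variation_sum_def sum_distrib_left by (rule sum.swap)
  also have "\<dots> \<le> (\<Sum>i\<in>S. \<bar>w i\<bar> * 1)"
    using f Is by (intro sum_mono mult_left_mono) (auto simp: schramm_var_le_1_iff[OF young])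
  finally show "variation_sum \<phi> (\<lambda>t. \<Sum>i\<in>S. w i * f i t) Is \<le> 1" using w by simp
qed

lemma schramm_var_scale:
  assumes young: "\<And>n. young_function (\<phi> n)" and "\<bar>c\<bar> \<le> 1" and "schramm_var \<phi> x \<le> 1"
  shows "schramm_var \<phi> (\<lambda>t. c * x t) \<le> 1"
  using schramm_var_combination[OF young, where S="{()}" and w="\<lambda>_. c" and f="\<lambda>_. x"] assms by simp

text \<open>For a fixed list the variation sum depends continuously on finitely many values of the
  function, so each bound by 1 survives the limit.\<close>

lemma schramm_var_limit:
  assumes young: "\<And>n. young_function (\<phi> n)"
    and lim: "\<And>t. t \<in> {0..1} \<Longrightarrow> (\<lambda>m. f m t) \<longlonglongrightarrow> g t"
    and f: "\<And>m. schramm_var \<phi> (f m) \<le> 1"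
  shows "schramm_var \<phi> g \<le> 1"
  unfolding schramm_var_le_1_iff[OF young]
proof
  fix Is assume Is: "Is \<in> nonoverlapping_lists"
  have "(\<lambda>m. variation_sum \<phi> (f m) Is) \<longlonglongrightarrow> variation_sum \<phi> g Is"
    unfolding variation_sum_def
  proof (rule tendsto_sum)
    fix n assume "n \<in> {..<length Is}"
    with nonoverlapping_lists_nth[OF Is, of n]
    have "fst (Is ! n) \<in> {0..1}" "snd (Is ! n) \<in> {0..1}" by auto
    then have "(\<lambda>m. f m (snd (Is ! n)) - f m (fst (Is ! n)))
        \<longlonglongrightarrow> g (snd (Is ! n)) - g (fst (Is ! n))"
      by (intro tendsto_diff lim)
    from isCont_tendsto_compose[OF young_abs_continuous[OF young] this]
    show "(\<lambda>m. \<phi> n \<bar>f m (snd (Is ! n)) - f m (fst (Is ! n))\<bar>)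
        \<longlonglongrightarrow> \<phi> n \<bar>g (snd (Is ! n)) - g (fst (Is ! n))\<bar>" .
  qed
  then show "variation_sum \<phi> g Is \<le> 1"
    by (rule LIMSEQ_le_const2) (use f Is in \<open>auto simp: schramm_var_le_1_iff[OF young]\<close>)
qed

lemma PhiBV_scale_le_1:
  assumes young: "\<And>n. young_function (\<phi> n)" and "x \<in> PhiBV \<phi>"
  obtains c where "c > 0" "schramm_var \<phi> (\<lambda>t. c * x t) \<le> 1"
proof -
  obtain c where c: "c > 0" "schramm_var \<phi> (\<lambda>t. c * x t) < \<infinity>"
    using assms(2) by (auto simp: PhiBV_def)
  \<comment> \<open>Adding 1 guarantees \<open>v \<ge> 1\<close>, so \<open>young_scale\<close>
    applies to the factor \<open>1 / v\<close> and brings the variation from at most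
    \<open>v\<close> down to at most 1.\<close>
  define v where "v = enn2real (schramm_var \<phi> (\<lambda>t. c * x t)) + 1"
  have v: "v \<ge> 1" by (simp add: v_def)
  have "schramm_var \<phi> (\<lambda>t. c * x t) \<le> ennreal v"
    using c(2) by (simp add: v_def)
  then have *: "variation_sum \<phi> (\<lambda>t. c * x t) Is \<le> v" if "Is \<in> nonoverlapping_lists" for Is
    using schramm_var_le_iff[of \<phi> v "\<lambda>t. c * x t"] young_nonneg[OF young] v that by auto
  have "variation_sum \<phi> (\<lambda>t. (c / v) * x t) Is \<le> 1" if Is: "Is \<in> nonoverlapping_lists" for Is
  proof -
    have "variation_sum \<phi> (\<lambda>t. (c / v) * x t) Is
        \<le> (\<Sum>n<length Is. (1 / v) * \<phi> n \<bar>c * x (snd (Is ! n)) - c * x (fst (Is ! n))\<bar>)"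
      unfolding variation_sum_def
    proof (rule sum_mono)
      fix n
      have "\<bar>(c / v) * x (snd (Is ! n)) - (c / v) * x (fst (Is ! n))\<bar>
          = (1 / v) * \<bar>c * x (snd (Is ! n)) - c * x (fst (Is ! n))\<bar>"
        using v by (simp flip: diff_divide_distrib)
      then show "\<phi> n \<bar>(c / v) * x (snd (Is ! n)) - (c / v) * x (fst (Is ! n))\<bar>
          \<le> (1 / v) * \<phi> n \<bar>c * x (snd (Is ! n)) - c * x (fst (Is ! n))\<bar>"
        using young_scale[OF young, of "1 / v"] v by simp
    qed
    also have "\<dots> = (1 / v) * variation_sum \<phi> (\<lambda>t. c * x t) Is"
      by (simp add: variation_sum_def sum_distrib_left)
    also have "\<dots> \<le> (1 / v) * v" using * Is v by (intro mult_left_mono) auto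
    finally show ?thesis using v by simp
  qed
  then have "schramm_var \<phi> (\<lambda>t. (c / v) * x t) \<le> 1"
    by (simp add: schramm_var_le_1_iff[OF young])
  then show ?thesis using that[of "c / v"] c v by simp
qed

text \<open>Some admissible \<open>d\<close> lies below 1 because the infimum does; multiplying
  \<open>inverse d * x\<close> by \<open>d\<close> stays inside the unit ball and gives back
  \<open>x\<close>.\<close>

lemma schramm_var_le_1_if_norm_Phi_less_1:
  assumes young: "\<And>n. young_function (\<phi> n)" and x: "x \<in> PhiBV \<phi>" and "norm_Phi \<phi> x < 1"
  shows "schramm_var \<phi> x \<le> 1"
proof -
  let ?A = "{c. c > 0 \<and> schramm_var \<phi> (\<lambda>t. inverse c * x t) \<le> 1}"
  obtain c where "c > 0" "schramm_var \<phi> (\<lambda>t. c * x t) \<le> 1"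
    using PhiBV_scale_le_1[OF young x] .
  \<comment> \<open>The infimum of an empty set of reals carries no information; membership in
    \<open>PhiBV\<close> supplies an element.\<close>
  then have ne: "?A \<noteq> {}" by (auto intro!: exI[of _ "inverse c"])
  have "Inf ?A < 1" using assms(3) by (simp add: norm_Phi_def seminorm_Phi_def)
  then obtain d where d: "d < 1" "d > 0" "schramm_var \<phi> (\<lambda>t. inverse d * x t) \<le> 1"
    using cInf_lessD[OF ne] by auto
  have "schramm_var \<phi> (\<lambda>t. d * (inverse d * x t)) \<le> 1"
    by (rule schramm_var_scale[OF young]) (use d in auto)
  then show ?thesis using d by (simp flip: mult.assoc)
qed

lemma seminorm_Phi_le:
  assumes "R > 0" "schramm_var \<phi> (\<lambda>t. inverse R * x t) \<le> 1"
  shows "seminorm_Phi \<phi> x \<le> R"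
  unfolding seminorm_Phi_def by (rule cInf_lower) (use assms in \<open>auto intro: bdd_belowI[of _ 0]\<close>)

section \<open>Functions of bounded variation\<close>

lemma jordan_var_le_iff:
  "0 \<le> C \<Longrightarrow> jordan_var x \<le> ennreal C \<longleftrightarrow>
    (\<forall>Is\<in>nonoverlapping_lists. variation_sum (\<lambda>_ t. t) x Is \<le> C)"
  unfolding jordan_var_def by (rule schramm_var_le_iff) auto

lemma variation_sum_le_jordan_var:
  assumes "x \<in> BV" "Is \<in> nonoverlapping_lists"
  shows "variation_sum (\<lambda>_ t. t) x Is \<le> enn2real (jordan_var x)"
  using jordan_var_le_iff[of "enn2real (jordan_var x)" x] assms by (auto simp: BV_def)

lemma BV_I:
  assumes "0 \<le> C" "\<And>Is. Is \<in> nonoverlapping_lists \<Longrightarrow> variation_sum (\<lambda>_ t. t) x Is \<le> C"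
  shows "x \<in> BV" "norm_BV x \<le> \<bar>x 0\<bar> + C"
proof -
  have *: "jordan_var x \<le> ennreal C" using assms by (simp add: jordan_var_le_iff)
  then show "x \<in> BV" by (auto simp: BV_def less_top[symmetric] top_unique)
  show "norm_BV x \<le> \<bar>x 0\<bar> + C"
    using enn2real_mono[OF *] assms(1) by (simp add: norm_BV_def)
qed

lemma BV_diff:
  assumes "x \<in> BV" "y \<in> BV"
  shows "(\<lambda>t. y t - x t) \<in> BV"
proof (rule BV_I(1))
  fix Is assume Is: "Is \<in> nonoverlapping_lists"
  have "variation_sum (\<lambda>_ t. t) (\<lambda>t. y t - x t) Is
      \<le> variation_sum (\<lambda>_ t. t) y Is + variation_sum (\<lambda>_ t. t) x Is"
    unfolding variation_sum_def sum.distrib[symmetric] by (rule sum_mono) linarith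
  then show "variation_sum (\<lambda>_ t. t) (\<lambda>t. y t - x t) Is
      \<le> enn2real (jordan_var y) + enn2real (jordan_var x)"
    using variation_sum_le_jordan_var[OF assms(1) Is] variation_sum_le_jordan_var[OF assms(2) Is]
    by linarith
qed simp

lemma BV_increment_le:
  assumes "x \<in> BV" "t \<in> {0..1}"
  shows "\<bar>x t - x 0\<bar> \<le> enn2real (jordan_var x)"
proof -
  have "[(0, t)] \<in> nonoverlapping_lists" using assms by (simp add: nonoverlapping_lists_def)
  from variation_sum_le_jordan_var[OF assms(1) this] show ?thesis by (simp add: variation_sum_def)
qed

lemma BV_abs_le:
  assumes "x \<in> BV" "t \<in> {0..1}"
  shows "\<bar>x t\<bar> \<le> norm_BV x"
  using BV_increment_le[OF assms] by (simp add: norm_BV_def)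

lemma norm_BV_nonneg: "0 \<le> norm_BV x"
  by (simp add: norm_BV_def)

lemma BV_uniform_partition:
  assumes "x \<in> BV" "n > 0"
  shows "(\<Sum>i<n. \<bar>x (real (Suc i) / real n) - x (real i / real n)\<bar>) \<le> enn2real (jordan_var x)"
proof -
  define I where "I i = (real i / real n, real (Suc i) / real n)" for i
  define Is where "Is = map I [0..<n]"
  have inj: "inj I" using assms by (auto simp: inj_def I_def)
  have no: "nonoverlapping (I i) (I j)" if "i < j" for i j
  proof -
    have ij: "real (Suc i) \<le> real j" using that by simp
    \<comment> \<open>All common points coincide, so the intersection is empty or a singleton;
      adjacent grid intervals do share their common endpoint.\<close>
    have sub: "a = real j / real n" if "a \<in> {fst (I i)..snd (I i)} \<inter> {fst (I j)..snd (I j)}" for a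
    proof -
      have "a \<le> real (Suc i) / real n" "real j / real n \<le> a" using that by (auto simp: I_def)
      moreover have "real (Suc i) / real n \<le> real j / real n"
        using ij by (rule divide_right_mono) simp
      ultimately show ?thesis by linarith
    qed
    show ?thesis unfolding nonoverlapping_def
      using is_singletonI'[of "{fst (I i)..snd (I i)} \<inter> {fst (I j)..snd (I j)}"] sub by blast
  qed
  have no': "nonoverlapping (I i) (I j)" if "i \<noteq> j" for i j
    using no[of i j] no[of j i] that by (cases "i < j") (auto simp: nonoverlapping_def Int_commute)
  have "Is \<in> nonoverlapping_lists"
    unfolding nonoverlapping_lists_def
  proof (intro CollectI conjI)
    show "\<forall>(a, b)\<in>set Is. 0 \<le> a \<and> a \<le> b \<and> b \<le> 1"
      using assms by (auto simp: Is_def I_def divide_simps)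
    show "distinct Is" using inj by (auto simp: Is_def distinct_map inj_on_def)
    show "pairwise nonoverlapping (set Is)"
      by (auto simp: pairwise_def Is_def intro!: no')
  qed
  from variation_sum_le_jordan_var[OF assms(1) this]
  show ?thesis by (simp add: variation_sum_def Is_def I_def)
qed

text \<open>Only an interval that crosses the jump at \<open>\<xi>\<close> contributes, and
  non-overlapping intervals allow at most one such. The norm bound adds the value \<open>c\<close>
  at 0 to this single jump of height \<open>c\<close>.\<close>

lemma BV_scaled_indicator:
  assumes \<xi>: "\<xi> \<in> {0..1}" and c: "c \<ge> 0"
  defines "y \<equiv> (\<lambda>s. c * indicator {0..\<xi>} s)"
  shows "y \<in> BV" "norm_BV y \<le> 2 * c"
proof -
  have *: "variation_sum (\<lambda>_ t. t) y Is \<le> c" if Is: "Is \<in> nonoverlapping_lists" for Is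
  proof -
    define g where "g n = \<bar>y (snd (Is ! n)) - y (fst (Is ! n))\<bar>" for n
    have le: "g n \<le> c" for n using c by (auto simp: g_def y_def indicator_def)
    have cross: "fst (Is ! n) \<le> \<xi> \<and> \<xi> < snd (Is ! n)" if "n < length Is" "g n \<noteq> 0" for n
      using nonoverlapping_lists_nth[OF Is that(1)] that(2)
      by (cases "fst (Is ! n) \<le> \<xi>"; cases "snd (Is ! n) \<le> \<xi>") (auto simp: g_def y_def)
    have unique: "n = m" if n: "n < length Is" "g n \<noteq> 0" and m: "m < length Is" "g m \<noteq> 0" for n m
    proof (rule ccontr)
      assume "n \<noteq> m"
      then have "Is ! n \<noteq> Is ! m"
        using Is n m by (auto simp: nonoverlapping_lists_def nth_eq_iff_index_eq)
      then have "nonoverlapping (Is ! n) (Is ! m)"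
        using Is n m by (auto simp: nonoverlapping_lists_def pairwise_def)
      \<comment> \<open>Both intervals contain \<open>\<xi>\<close> and extend strictly beyond it,
        so the smaller right endpoint \<open>b\<close> is a second common point.\<close>
      moreover define b where "b = min (snd (Is ! n)) (snd (Is ! m))"
      let ?J = "{fst (Is ! n)..snd (Is ! n)} \<inter> {fst (Is ! m)..snd (Is ! m)}"
      have "\<xi> \<in> ?J" "b \<in> ?J" "\<xi> \<noteq> b"
        using cross[OF n] cross[OF m] by (auto simp: b_def min_def)
      ultimately show False
        unfolding nonoverlapping_def is_singleton_def by (metis empty_iff singletonD)
    qed
    have "(\<Sum>n<length Is. g n) \<le> c"
    proof (cases "\<exists>m<length Is. g m \<noteq> 0")
      case True
      then obtain m where m: "m < length Is" "g m \<noteq> 0" by blast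
      have "(\<Sum>n<length Is. g n) = (\<Sum>n\<in>{m}. g n)"
        by (rule sum.mono_neutral_right) (use m unique in auto)
      then show ?thesis using le[of m] by simp
    qed (use c in auto)
    then show ?thesis by (simp add: variation_sum_def g_def)
  qed
  show "y \<in> BV" using BV_I(1)[OF c *] .
  show "norm_BV y \<le> 2 * c" using BV_I(2)[OF c *] \<xi> c by (simp add: y_def)
qed

section \<open>Jordan decomposition, discontinuities and measurability\<close>

text \<open>The variation function of \<open>x\<close>: its variation over \<open>[0,t]\<close>.
  Bounding right endpoints suffices, since left endpoints are nonnegative already.\<close>

definition variation_upto :: "(real \<Rightarrow> real) \<Rightarrow> real \<Rightarrow> real" where
  "variation_upto x t =
    (SUP Is \<in> {Is \<in> nonoverlapping_lists. \<forall>I\<in>set Is. snd I \<le> t}. variation_sum (\<lambda>_ t. t) x Is)"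

text \<open>Any list of intervals inside \<open>[0,s]\<close> may be extended by the interval from
  \<open>s\<close> to \<open>t\<close>. The absolute value yields monotonicity of the variation
  function and of its difference with \<open>x\<close> at once.\<close>

lemma variation_upto_increment:
  assumes x: "x \<in> BV" and st: "0 \<le> s" "s \<le> t" "t \<le> 1"
  shows "variation_upto x s + \<bar>x t - x s\<bar> \<le> variation_upto x t"
proof (cases "s = t")
  case False
  then have "s < t" using st by simp
  define L where "L r = {Is \<in> nonoverlapping_lists. \<forall>I\<in>set Is. snd I \<le> r}" for r :: real
  have bdd: "bdd_above (variation_sum (\<lambda>_ t. t) x ` L r)" for r
    using variation_sum_le_jordan_var[OF x]
    by (auto simp: L_def intro!: bdd_aboveI2[of _ _ "enn2real (jordan_var x)"])
  have ne: "L r \<noteq> {}" for r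
    by (auto simp: L_def nonoverlapping_lists_def intro!: exI[of _ "[]"])
  have "variation_upto x s \<le> variation_upto x t - \<bar>x t - x s\<bar>"
    unfolding variation_upto_def L_def[symmetric]
  proof (rule cSUP_least[OF ne])
    fix Is assume Is: "Is \<in> L s"
    then have Is': "Is \<in> nonoverlapping_lists" and b: "\<And>I. I \<in> set Is \<Longrightarrow> snd I \<le> s"
      by (auto simp: L_def)
    \<comment> \<open>Strictness of \<open>s < t\<close> is used here: the lists must be distinct,
      and a degenerate interval could already occur in \<open>Is\<close>.\<close>
    have new: "(s, t) \<notin> set Is" using b[of "(s, t)"] \<open>s < t\<close> by auto
    have no: "nonoverlapping I (s, t)" if "I \<in> set Is" for I
    proof -
      have "a = s" if "a \<in> {fst I..snd I} \<inter> {fst (s, t)..snd (s, t)}" for a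
        using that b[OF \<open>I \<in> set Is\<close>] by auto
      then show ?thesis
        unfolding nonoverlapping_def
        using is_singletonI'[of "{fst I..snd I} \<inter> {fst (s, t)..snd (s, t)}"] by blast
    qed
    have no': "nonoverlapping (s, t) I" if "I \<in> set Is" for I
      using no[OF that] by (simp add: nonoverlapping_def Int_commute)
    have "Is @ [(s, t)] \<in> nonoverlapping_lists"
      using Is' new no no' st
      by (auto simp: nonoverlapping_lists_def pairwise_insert)
    then have "Is @ [(s, t)] \<in> L t"
      using b st by (force simp: L_def)
    from cSUP_upper[OF this bdd[of t]]
    have "variation_sum (\<lambda>_ t. t) x (Is @ [(s, t)]) \<le> (SUP Is\<in>L t. variation_sum (\<lambda>_ t. t) x Is)" .
    moreover have "variation_sum (\<lambda>_ t. t) x (Is @ [(s, t)])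
        = variation_sum (\<lambda>_ t. t) x Is + \<bar>x t - x s\<bar>"
      by (simp add: variation_sum_def nth_append)
    ultimately show "variation_sum (\<lambda>_ t. t) x Is
        \<le> (SUP Is\<in>L t. variation_sum (\<lambda>_ t. t) x Is) - \<bar>x t - x s\<bar>"
      by linarith
  qed
  then show ?thesis by simp
qed simp

lemma BV_Jordan_decomposition:
  assumes "x \<in> BV"
  obtains u v where "mono_on {0..1} u" "mono_on {0..1} v" "x = (\<lambda>t. u t - v t)"
proof
  show "mono_on {0..1} (variation_upto x)"
    using variation_upto_increment[OF assms] by (force intro!: mono_onI)
  show "mono_on {0..1} (\<lambda>t. variation_upto x t - x t)"
    using variation_upto_increment[OF assms] by (force intro!: mono_onI)
qed simp

text \<open>A discontinuity of \<open>x\<close> must be one of a monotone component, and monotone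
  functions have only countably many.\<close>

lemma BV_countable_discontinuities:
  assumes "x \<in> BV"
  shows "countable {s \<in> {0..1}. \<not> continuous (at s within {0..1}) x}"
proof -
  obtain u v where uv: "mono_on {0..1} u" "mono_on {0..1} v" "x = (\<lambda>t. u t - v t)"
    using BV_Jordan_decomposition[OF assms] .
  have "{s \<in> {0..1}. \<not> continuous (at s within {0..1}) x}
      \<subseteq> {s \<in> {0..1}. \<not> continuous (at s within {0..1}) u} \<union>
        {s \<in> {0..1}. \<not> continuous (at s within {0..1}) v}"
    unfolding uv(3) by (auto intro: continuous_diff)
  then show ?thesis
    by (rule countable_subset)
      (intro countable_Un mono_on_ctble_discont uv(1,2))
qed

lemma BV_measurable:
  assumes "x \<in> BV"
  shows "set_borel_measurable lebesgue {0..1} x"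
proof -
  obtain u v where uv: "mono_on {0..1} u" "mono_on {0..1} v" "x = (\<lambda>t. u t - v t)"
    using BV_Jordan_decomposition[OF assms] .
  have "x \<in> borel_measurable (restrict_space borel {0..1})"
    unfolding uv(3)
    by (intro borel_measurable_diff borel_measurable_mono_on_fnc uv(1,2))
  then have "(\<lambda>s. indicator {0..1} s *\<^sub>R x s) \<in> borel_measurable borel"
    by (subst (asm) borel_measurable_restrict_space_iff) auto
  then show ?thesis
    unfolding set_borel_measurable_def by (intro measurable_completion) simp
qed

section \<open>Products of an integrable function with a function of bounded variation\<close>

lemma kernel_times_BV_integrable:
  assumes h: "set_integrable lebesgue {0..1} h" and x: "x \<in> BV"
  shows "set_integrable lebesgue {0..1} (\<lambda>s. h s * x s)"
proof -
  have hi: "integrable lebesgue (\<lambda>s. norm_BV x * (indicator {0..1} s *\<^sub>R h s))"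
    using h unfolding set_integrable_def by (rule integrable_mult_right)
  have "(\<lambda>s. (indicator {0..1} s *\<^sub>R h s) * (indicator {0..1} s *\<^sub>R x s)) \<in> borel_measurable lebesgue"
    using h BV_measurable[OF x] unfolding set_integrable_def set_borel_measurable_def
    by (intro borel_measurable_times) auto
  also have "(\<lambda>s. (indicator {0..1} s *\<^sub>R h s) * (indicator {0..1} s *\<^sub>R x s))
      = (\<lambda>s. indicator {0..1} s *\<^sub>R (h s * x s))"
    by (auto simp: indicator_def)
  finally have meas: "(\<lambda>s. indicator {0..1} s *\<^sub>R (h s * x s)) \<in> borel_measurable lebesgue" .
  show ?thesis
    unfolding set_integrable_def
  proof (rule Bochner_Integration.integrable_bound[OF hi meas], rule AE_I2)
    fix s
    show "norm (indicator {0..1} s *\<^sub>R (h s * x s)) \<le> norm (norm_BV x * (indicator {0..1} s *\<^sub>R h s))"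
    proof (cases "s \<in> {0..1}")
      case True
      then show ?thesis
        using mult_right_mono[OF BV_abs_le[OF x True], of "\<bar>h s\<bar>"] norm_BV_nonneg[of x]
        by (simp add: abs_mult mult.commute)
    qed simp
  qed
qed

text \<open>Applied to the kernel at \<open>t = 0\<close>, this controls the summand of
  \<open>norm_Phi\<close> that the Schramm variation does not see.\<close>

lemma kernel_times_BV_integral_bound:
  assumes h: "set_integrable lebesgue {0..1} h" and x: "x \<in> BV"
  shows "\<bar>LINT s:{0..1}|lebesgue. h s * x s\<bar> \<le> (LINT s:{0..1}|lebesgue. \<bar>h s\<bar>) * norm_BV x"
proof -
  have "(LINT s|lebesgue. norm (indicator {0..1} s *\<^sub>R (h s * x s)))
      \<le> (LINT s|lebesgue. (indicator {0..1} s *\<^sub>R \<bar>h s\<bar>) * norm_BV x)"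
  proof (rule integral_mono)
    show "integrable lebesgue (\<lambda>s. norm (indicator {0..1} s *\<^sub>R (h s * x s)))"
      using kernel_times_BV_integrable[OF assms]
      unfolding set_integrable_def by (rule integrable_norm)
    show "integrable lebesgue (\<lambda>s. indicator {0..1} s *\<^sub>R \<bar>h s\<bar> * norm_BV x)"
      using set_integrable_abs[OF h] unfolding set_integrable_def by (rule integrable_mult_left)
  qed (auto simp: indicator_def abs_mult intro!: mult_left_mono BV_abs_le[OF x])
  then show ?thesis
    using order_trans[OF integral_norm_bound, of lebesgue "\<lambda>s. indicator {0..1} s *\<^sub>R (h s * x s)"]
    by (simp add: set_lebesgue_integral_def)
qed

section \<open>Approximation by step functions\<close>

text \<open>
  Coefficients produced by Abel summation: the step function that takes the value
  \<open>x (i / n)\<close> on \<open>((i - 1) / n, i / n]\<close> is their combination with the indicators of \<open>[0, i / n]\<close>.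
\<close>

definition step_coeff :: "(real \<Rightarrow> real) \<Rightarrow> nat \<Rightarrow> nat \<Rightarrow> real" where
  "step_coeff x n i = (if i = n then x 1 else x (real i / real n) - x (real (Suc i) / real n))"

definition step_approx :: "(real \<Rightarrow> real) \<Rightarrow> nat \<Rightarrow> real \<Rightarrow> real" where
  "step_approx x n s = (\<Sum>i\<le>n. step_coeff x n i * indicator {0..real i / real n} s)"

text \<open>The coefficients with \<open>i < n\<close> are increments over the uniform partition,
  hence bounded by the Jordan variation; the last one is \<open>x 1\<close>, bounded by the
  norm.\<close>

lemma step_coeff_sum_le:
  assumes "x \<in> BV" "n > 0"
  shows "(\<Sum>i\<le>n. \<bar>step_coeff x n i\<bar>) \<le> 2 * norm_BV x"
proof -
  have "(\<Sum>i\<le>n. \<bar>step_coeff x n i\<bar>) = (\<Sum>i<n. \<bar>step_coeff x n i\<bar>) + \<bar>x 1\<bar>"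
    by (simp add: lessThan_Suc_atMost[symmetric] step_coeff_def)
  also have "(\<Sum>i<n. \<bar>step_coeff x n i\<bar>)
      = (\<Sum>i<n. \<bar>x (real (Suc i) / real n) - x (real i / real n)\<bar>)"
    by (rule sum.cong) (auto simp: step_coeff_def)
  finally show ?thesis
    using BV_uniform_partition[OF assms] BV_abs_le[OF assms(1), of 1] by (simp add: norm_BV_def)
qed

text \<open>A point \<open>s\<close> lies in \<open>[0, i/n]\<close> exactly when the ceiling
  \<open>m\<close> of \<open>n s\<close> is at most \<open>i\<close>. The surviving coefficients
  telescope from \<open>x (m / n)\<close> to \<open>x 1\<close>, and the last coefficient cancels
  \<open>x 1\<close>.\<close>

lemma step_approx_eq:
  assumes n: "n > 0" and s: "s \<in> {0..1}"
  shows "step_approx x n s = x (of_int \<lceil>real n * s\<rceil> / real n)"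
proof -
  define m where "m = nat \<lceil>real n * s\<rceil>"
  have c0: "\<lceil>real n * s\<rceil> \<ge> 0" using s n by (simp add: order.strict_trans2[of "-1" 0])
  have mr: "real m = of_int \<lceil>real n * s\<rceil>" using c0 by (simp add: m_def)
  have "real n * s \<le> real n" using s n by (simp add: mult_left_le)
  then have mn: "m \<le> n" by (simp add: m_def nat_le_iff ceiling_le_iff)
  have iff: "s \<in> {0..real i / real n} \<longleftrightarrow> m \<le> i" for i
  proof -
    have "s \<in> {0..real i / real n} \<longleftrightarrow> real n * s \<le> real i"
      using s n by (simp add: pos_le_divide_eq mult.commute)
    also have "\<dots> \<longleftrightarrow> \<lceil>real n * s\<rceil> \<le> int i" by (simp add: ceiling_le_iff)
    finally show ?thesis by (simp add: m_def nat_le_iff)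
  qed
  have "step_approx x n s = (\<Sum>i\<in>{m..n}. step_coeff x n i)"
    unfolding step_approx_def
    by (rule sum.mono_neutral_cong_right) (auto simp del: atLeastAtMost_iff simp: iff atLeastAtMost_iff[of _ m n])
  also have "\<dots> = x 1 + (\<Sum>i\<in>{m..<n}. step_coeff x n i)"
    using mn by (simp add: atLeastLessThanSuc_atLeastAtMost[symmetric] step_coeff_def)
  also have "(\<Sum>i\<in>{m..<n}. step_coeff x n i)
      = - (\<Sum>i\<in>{m..<n}. x (real (Suc i) / real n) - x (real i / real n))"
    unfolding sum_negf[symmetric] by (rule sum.cong) (auto simp: step_coeff_def)
  also have "\<dots> = x (real m / real n) - x 1"
    using sum_Suc_diff'[OF mn, of "\<lambda>i. x (real i / real n)"] n by simp
  finally show ?thesis by (simp add: mr)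
qed

lemma ceiling_grid:
  assumes n: "n > 0" and s: "s \<in> {0..1}"
  shows "of_int \<lceil>real n * s\<rceil> / real n \<in> {0..1}"
    and "\<bar>of_int \<lceil>real n * s\<rceil> / real n - s\<bar> \<le> 1 / real n"
proof -
  let ?c = "of_int \<lceil>real n * s\<rceil> :: real"
  have c: "real n * s \<le> ?c" "?c \<le> real n * s + 1" by linarith+
  have "0 \<le> real n * s" using s by simp
  then have "0 \<le> ?c" using c by linarith
  moreover have "\<lceil>real n * s\<rceil> \<le> int n" using s n by (simp add: ceiling_le_iff mult_left_le)
  then have "?c \<le> real n" by linarith
  ultimately show "?c / real n \<in> {0..1}" using n by simp
  have "?c / real n - s = (?c - real n * s) / real n" using n by (simp add: field_simps)
  moreover have "(?c - real n * s) / real n \<le> 1 / real n"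
    by (rule divide_right_mono) (use c in linarith, simp)
  moreover have "0 \<le> (?c - real n * s) / real n" using c by simp
  ultimately show "\<bar>?c / real n - s\<bar> \<le> 1 / real n" by linarith
qed

text \<open>The sampling points stay in \<open>[0,1]\<close> and differ from \<open>s\<close> by at
  most the mesh, so one-sided continuity at the endpoints of \<open>[0,1]\<close> is enough.\<close>

lemma step_approx_tendsto:
  assumes s: "s \<in> {0..1}" and cont: "continuous (at s within {0..1}) x"
  shows "(\<lambda>m. step_approx x (Suc m) s) \<longlonglongrightarrow> x s"
proof -
  define g where "g m = of_int \<lceil>real (Suc m) * s\<rceil> / real (Suc m)" for m
  have g: "g m \<in> {0..1}" "\<bar>g m - s\<bar> \<le> 1 / real (Suc m)" for m
    unfolding g_def by (rule ceiling_grid; use s in simp)+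
  have "(\<lambda>m. g m - s) \<longlonglongrightarrow> 0"
    by (rule Lim_null_comparison[OF _ LIMSEQ_inverse_real_of_nat])
      (use g(2) in \<open>simp add: inverse_eq_divide\<close>)
  then have "g \<longlonglongrightarrow> s" by (simp add: LIM_zero_iff)
  then have "(\<lambda>m. x (g m)) \<longlonglongrightarrow> x s"
    using cont s g(1) unfolding continuous_within_sequentially by (auto simp: o_def)
  then show ?thesis using step_approx_eq[OF _ s] by (simp add: g_def)
qed

section \<open>Images of the step functions and their limit\<close>

text \<open>Linearity of the integral. The cut-off to \<open>[0,1]\<close> is absorbed because every
  \<open>[0, i/n]\<close> with \<open>i \<le> n\<close> lies inside it.\<close>

lemma integral_operator_step_approx:
  assumes h: "set_integrable lebesgue {0..1} (k t)"
  shows "integral_operator k (step_approx x (Suc m)) t =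
      (\<Sum>i\<le>Suc m. step_coeff x (Suc m) i * (LINT s:{0..real i / real (Suc m)}|lebesgue. k t s))"
proof -
  have "integral_operator k (step_approx x (Suc m)) t
      = (LINT s|lebesgue. (\<Sum>i\<le>Suc m. step_coeff x (Suc m) i *
          (indicator {0..real i / real (Suc m)} s *\<^sub>R k t s)))"
    unfolding integral_operator_def set_lebesgue_integral_def
  proof (rule Bochner_Integration.integral_cong[OF refl])
    fix s
    have "indicator {0..1} s * (k t s * (c * indicator {0..real i / real (Suc m)} s))
        = c * (indicator {0..real i / real (Suc m)} s * k t s)" if "i \<le> Suc m" for i and c :: real
    proof -
      have "real i / real (Suc m) \<le> 1" using that by simp
      then have "s \<in> {0..1}" if "s \<in> {0..real i / real (Suc m)}"
        using that unfolding atLeastAtMost_iff by linarith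
      then show ?thesis by (cases "s \<in> {0..real i / real (Suc m)}") simp_all
    qed
    then show "indicator {0..1} s *\<^sub>R (k t s * step_approx x (Suc m) s)
        = (\<Sum>i\<le>Suc m. step_coeff x (Suc m) i * (indicator {0..real i / real (Suc m)} s *\<^sub>R k t s))"
      unfolding step_approx_def sum_distrib_left real_scaleR_def
      by (intro sum.cong[OF refl]) auto
  qed
  also have "\<dots> = (\<Sum>i\<le>Suc m. (LINT s|lebesgue. step_coeff x (Suc m) i *
          (indicator {0..real i / real (Suc m)} s *\<^sub>R k t s)))"
  proof (rule Bochner_Integration.integral_sum)
    fix i assume "i \<in> {..Suc m}"
    then have "{0..real i / real (Suc m)} \<subseteq> {0..1}" by auto
    then have "set_integrable lebesgue {0..real i / real (Suc m)} (k t)"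
      by (intro set_integrable_subset[OF h]) auto
    then show "integrable lebesgue (\<lambda>s. step_coeff x (Suc m) i *
          (indicator {0..real i / real (Suc m)} s *\<^sub>R k t s))"
      unfolding set_integrable_def by (rule integrable_mult_right)
  qed
  finally show ?thesis by (simp add: set_lebesgue_integral_def)
qed

lemma integral_operator_step_approx_tendsto:
  assumes h: "set_integrable lebesgue {0..1} (k t)" and x: "x \<in> BV"
  shows "(\<lambda>m. integral_operator k (step_approx x (Suc m)) t) \<longlonglongrightarrow> integral_operator k x t"
  unfolding integral_operator_def set_lebesgue_integral_def
proof (rule integral_dominated_convergence)
  let ?D = "{s \<in> {0..1}. \<not> continuous (at s within {0..1}) x}"
  show "integrable lebesgue (\<lambda>s. norm_BV x * (indicator {0..1} s *\<^sub>R \<bar>k t s\<bar>))"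
    using set_integrable_abs[OF h] unfolding set_integrable_def by (rule integrable_mult_right)
  show "(\<lambda>s. indicator {0..1} s *\<^sub>R (k t s * x s)) \<in> borel_measurable lebesgue"
    using kernel_times_BV_integrable[OF h x] unfolding set_integrable_def by auto
  show "(\<lambda>s. indicator {0..1} s *\<^sub>R (k t s * step_approx x (Suc m) s)) \<in> borel_measurable lebesgue" for m
  proof -
    have "(\<lambda>s. indicator {0..1} s *\<^sub>R k t s) \<in> borel_measurable lebesgue"
      using h unfolding set_integrable_def by auto
    moreover have "step_approx x (Suc m) \<in> borel_measurable lebesgue"
      unfolding step_approx_def by (intro measurable_completion) measurable
    ultimately have "(\<lambda>s. (indicator {0..1} s *\<^sub>R k t s) * step_approx x (Suc m) s) \<in> borel_measurable lebesgue"
      by (rule borel_measurable_times)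
    then show ?thesis by (simp add: mult.assoc)
  qed
  \<comment> \<open>Pointwise convergence may fail at discontinuities of \<open>x\<close>, but these
    form a countable set, hence a null set.\<close>
  have "?D \<in> null_sets lebesgue"
    by (intro null_sets_completionI countable_imp_null_set_lborel BV_countable_discontinuities x)
  then have "AE s in lebesgue. s \<notin> ?D" by (rule AE_not_in)
  then show "AE s in lebesgue. (\<lambda>m. indicator {0..1} s *\<^sub>R (k t s * step_approx x (Suc m) s))
      \<longlonglongrightarrow> indicator {0..1} s *\<^sub>R (k t s * x s)"
  proof eventually_elim
    case (elim s)
    show ?case
    proof (cases "s \<in> {0..1}")
      case True
      then show ?thesis using elim
        by (intro tendsto_intros step_approx_tendsto) auto
    qed simp
  qed
  show "AE s in lebesgue. norm (indicator {0..1} s *\<^sub>R (k t s * step_approx x (Suc m) s))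
      \<le> norm_BV x * (indicator {0..1} s *\<^sub>R \<bar>k t s\<bar>)" for m
  proof (rule AE_I2)
    fix s
    show "norm (indicator {0..1} s *\<^sub>R (k t s * step_approx x (Suc m) s))
      \<le> norm_BV x * (indicator {0..1} s *\<^sub>R \<bar>k t s\<bar>)"
    proof (cases "s \<in> {0..1}")
      case True
      \<comment> \<open>On \<open>[0,1]\<close> the step function takes only values of
        \<open>x\<close> at grid points, which gives a majorant independent of
        \<open>m\<close>.\<close>
      have "\<bar>step_approx x (Suc m) s\<bar> \<le> norm_BV x"
        unfolding step_approx_eq[OF zero_less_Suc True]
        by (rule BV_abs_le[OF x ceiling_grid(1)[OF zero_less_Suc True]])
      from mult_right_mono[OF this, of "\<bar>k t s\<bar>"] show ?thesis
        using True by (simp add: abs_mult mult.commute)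
    qed simp
  qed
qed

text \<open>Dividing by \<open>R\<close> makes the absolute sum of the Abel coefficients at most 1,
  so the images of the step functions lie in the unit ball; the limit stays there because the ball
  is closed under pointwise limits.\<close>

lemma schramm_var_integral_operator_le:
  assumes young: "\<And>n. young_function (\<phi> n)"
    and integrable: "\<And>t. t \<in> {0..1} \<Longrightarrow> set_integrable lebesgue {0..1} (k t)"
    and bound: "\<And>\<xi>. \<xi> \<in> {0..1} \<Longrightarrow>
      schramm_var \<phi> (\<lambda>t. \<mu> * (LINT s:{0..\<xi>}|lebesgue. k t s)) \<le> 1"
    and x: "x \<in> BV" and R: "R > 0" "2 * norm_BV x \<le> R"
  shows "schramm_var \<phi> (\<lambda>t. (\<mu> / R) * integral_operator k x t) \<le> 1"
proof (rule schramm_var_limit[OF young])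
  show "(\<lambda>m. (\<mu> / R) * integral_operator k (step_approx x (Suc m)) t)
      \<longlonglongrightarrow> (\<mu> / R) * integral_operator k x t" if "t \<in> {0..1}" for t
    by (intro tendsto_intros integral_operator_step_approx_tendsto integrable that x)
  fix m
  have "schramm_var \<phi> (\<lambda>t. (\<mu> / R) * integral_operator k (step_approx x (Suc m)) t)
      = schramm_var \<phi> (\<lambda>t. \<Sum>i\<le>Suc m. (step_coeff x (Suc m) i / R) *
          (\<mu> * (LINT s:{0..real i / real (Suc m)}|lebesgue. k t s)))"
  proof (rule schramm_var_cong)
    fix t :: real assume "t \<in> {0..1}"
    then have "integral_operator k (step_approx x (Suc m)) t =
        (\<Sum>i\<le>Suc m. step_coeff x (Suc m) i * (LINT s:{0..real i / real (Suc m)}|lebesgue. k t s))"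
      by (intro integral_operator_step_approx integrable)
    then show "(\<mu> / R) * integral_operator k (step_approx x (Suc m)) t =
        (\<Sum>i\<le>Suc m. (step_coeff x (Suc m) i / R) *
          (\<mu> * (LINT s:{0..real i / real (Suc m)}|lebesgue. k t s)))"
      by (simp add: sum_distrib_left mult_ac del: sum.atMost_Suc)
  qed
  also have "\<dots> \<le> 1"
  proof (rule schramm_var_combination[OF young])
    have "(\<Sum>i\<le>Suc m. \<bar>step_coeff x (Suc m) i / R\<bar>) = (\<Sum>i\<le>Suc m. \<bar>step_coeff x (Suc m) i\<bar>) / R"
      using R unfolding sum_divide_distrib by (intro sum.cong) auto
    also have "\<dots> \<le> R / R"
      using step_coeff_sum_le[OF x, of "Suc m"] R by (intro divide_right_mono) linarith+
    finally show "(\<Sum>i\<le>Suc m. \<bar>step_coeff x (Suc m) i / R\<bar>) \<le> 1" using R by simp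
    show "schramm_var \<phi> (\<lambda>t. \<mu> * (LINT s:{0..real i / real (Suc m)}|lebesgue. k t s)) \<le> 1"
      if "i \<in> {..Suc m}" for i
      by (rule bound) (use that in auto)
  qed simp
  finally show "schramm_var \<phi> (\<lambda>t. (\<mu> / R) * integral_operator k (step_approx x (Suc m)) t) \<le> 1" .
qed

section \<open>The characterization\<close>

theorem theorem10:
  fixes \<phi> :: "nat \<Rightarrow> real \<Rightarrow> real" and k :: "real \<Rightarrow> real \<Rightarrow> real"
  assumes young: "\<And>j. young_function (\<phi> j)"
    and decreasing: "\<And>j t. t > 0 \<Longrightarrow> \<phi> (Suc j) t \<le> \<phi> j t"
    and divergent: "\<And>t. t > 0 \<Longrightarrow> (\<Sum>n. ennreal (\<phi> n t)) = \<infinity>"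
    and integrable: "\<And>t. t \<in> {0..1} \<Longrightarrow> set_integrable lebesgue {0..1} (k t)"
  shows "((\<forall>x\<in>BV. integral_operator k x \<in> PhiBV \<phi>) \<and>
          norm_continuous_on BV norm_BV (norm_Phi \<phi>) (integral_operator k))
     \<longleftrightarrow> (\<exists>\<mu>>0. \<forall>\<xi>\<in>{0..1}.
            schramm_var \<phi> (\<lambda>t. \<mu> * (LINT s:{0..\<xi>}|lebesgue. k t s)) \<le> 1)"
    (is "?maps \<and> ?cont \<longleftrightarrow> ?bounded")
proof
  assume "?maps \<and> ?cont"
  then have maps: ?maps and cont: ?cont by auto
  have zero: "(\<lambda>_. 0) \<in> BV" by (rule BV_I(1)[of 0]) (auto simp: variation_sum_def)
  have K0: "integral_operator k (\<lambda>_. 0) = (\<lambda>_. 0)"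
    by (rule ext) (simp add: integral_operator_def set_lebesgue_integral_def)
  \<comment> \<open>Continuity at the zero function with tolerance 1.\<close>
  have "\<exists>\<delta>>0. \<forall>y\<in>BV. norm_BV y < \<delta> \<longrightarrow> norm_Phi \<phi> (integral_operator k y) < 1"
    using bspec[OF cont[unfolded norm_continuous_on_def] zero, THEN spec, of 1] by (simp add: K0)
  then obtain \<delta> where \<delta>: "\<delta> > 0"
    and small: "\<And>y. y \<in> BV \<Longrightarrow> norm_BV y < \<delta> \<Longrightarrow> norm_Phi \<phi> (integral_operator k y) < 1"
    by blast
  show ?bounded
  \<comment> \<open>The indicator scaled by \<open>\<delta> / 4\<close> has norm at most
    \<open>\<delta> / 2\<close>, strictly below \<open>\<delta>\<close>.\<close>
  proof (intro exI[of _ "\<delta> / 4"] conjI ballI)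
    show "\<delta> / 4 > 0" using \<delta> by simp
    fix \<xi> :: real assume \<xi>: "\<xi> \<in> {0..1}"
    define y where "y = (\<lambda>s. (\<delta> / 4) * indicator {0..\<xi>} s)"
    have y: "y \<in> BV" "norm_BV y \<le> 2 * (\<delta> / 4)"
      unfolding y_def by (rule BV_scaled_indicator[OF \<xi>]; use \<delta> in simp)+
    have "norm_Phi \<phi> (integral_operator k y) < 1"
      using small[OF y(1)] y(2) \<delta> by simp
    then have "schramm_var \<phi> (integral_operator k y) \<le> 1"
      by (intro schramm_var_le_1_if_norm_Phi_less_1 young bspec[OF maps y(1)])
    moreover have "integral_operator k y = (\<lambda>t. (\<delta> / 4) * (LINT s:{0..\<xi>}|lebesgue. k t s))"
    proof
      fix t
      have "integral_operator k y t
          = (LINT s|lebesgue. (\<delta> / 4) * (indicator {0..\<xi>} s *\<^sub>R k t s))"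
        unfolding integral_operator_def set_lebesgue_integral_def
        using \<xi> by (intro Bochner_Integration.integral_cong) (auto simp: y_def indicator_def)
      then show "integral_operator k y t = (\<delta> / 4) * (LINT s:{0..\<xi>}|lebesgue. k t s)"
        by (simp add: set_lebesgue_integral_def)
    qed
    ultimately show "schramm_var \<phi> (\<lambda>t. \<delta> / 4 * (LINT s:{0..\<xi>}|lebesgue. k t s)) \<le> 1"
      by simp
  qed
next
  assume ?bounded
  then obtain \<mu> where \<mu>: "\<mu> > 0" and bound: "\<And>\<xi>. \<xi> \<in> {0..1} \<Longrightarrow>
      schramm_var \<phi> (\<lambda>t. \<mu> * (LINT s:{0..\<xi>}|lebesgue. k t s)) \<le> 1"
    by blast
  note var_le = schramm_var_integral_operator_le[where \<phi>=\<phi>, OF young integrable bound]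
  have ?maps
  proof
    fix x assume x: "x \<in> BV"
    \<comment> \<open>The extra 1 keeps the divisor positive when the norm of \<open>x\<close> is
      0.\<close>
    have "schramm_var \<phi> (\<lambda>t. (\<mu> / (2 * norm_BV x + 1)) * integral_operator k x t) \<le> 1"
      by (rule var_le[OF _ _ x]) (use norm_BV_nonneg[of x] in auto)
    then have "schramm_var \<phi> (\<lambda>t. (\<mu> / (2 * norm_BV x + 1)) * integral_operator k x t) < \<infinity>"
      by (rule order.strict_trans1) simp
    moreover have "\<mu> / (2 * norm_BV x + 1) > 0" using \<mu> norm_BV_nonneg[of x] by simp
    ultimately show "integral_operator k x \<in> PhiBV \<phi>" unfolding PhiBV_def by blast
  qed
  moreover have ?cont
    unfolding norm_continuous_on_def
  proof (intro ballI allI impI)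
    fix x \<epsilon> assume x: "x \<in> BV" and \<epsilon>: "\<epsilon> > (0::real)"
    define C where "C = (LINT s:{0..1}|lebesgue. \<bar>k 0 s\<bar>)"
    have C: "C \<ge> 0" by (simp add: C_def set_lebesgue_integral_def)
    \<comment> \<open>The final estimate bounds the norm by \<open>(C + 2 / \<mu>) * r\<close> with
      \<open>r < \<delta>\<close>: \<open>C\<close> comes from the value at 0 and
      \<open>2 / \<mu>\<close> from the seminorm.\<close>
    define \<delta> where "\<delta> = \<epsilon> / (C + 2 / \<mu>)"
    have den: "C + 2 / \<mu> > 0" using C \<mu> by (simp add: add_nonneg_pos)
    then have \<delta>: "\<delta> > 0" using \<epsilon> by (simp add: \<delta>_def)
    show "\<exists>\<delta>>0. \<forall>y\<in>BV. norm_BV (\<lambda>t. y t - x t) < \<delta> \<longrightarrow>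
        norm_Phi \<phi> (\<lambda>t. integral_operator k y t - integral_operator k x t) < \<epsilon>"
    proof (intro exI[of _ \<delta>] conjI ballI impI \<delta>)
      fix y assume y: "y \<in> BV" and less: "norm_BV (\<lambda>t. y t - x t) < \<delta>"
      define z where "z = (\<lambda>t. y t - x t)"
      have z: "z \<in> BV" unfolding z_def by (rule BV_diff[OF x y])
      \<comment> \<open>A number strictly between the norm of \<open>z\<close> and
        \<open>\<delta>\<close> is positive even when that norm vanishes, so \<open>2 * r\<close>
        can serve as the divisor \<open>R\<close>.\<close>
      define r where "r = (norm_BV z + \<delta>) / 2"
      have r: "r > 0" "norm_BV z < r" "r < \<delta>"
        using less \<delta> norm_BV_nonneg[of z] by (auto simp: r_def z_def)
      have "norm_Phi \<phi> (\<lambda>t. integral_operator k y t - integral_operator k x t)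
          = norm_Phi \<phi> (integral_operator k z)"
      proof (rule norm_Phi_cong)
        fix t :: real assume "t \<in> {0..1}"
        then have h: "set_integrable lebesgue {0..1} (k t)" by (rule integrable)
        show "integral_operator k y t - integral_operator k x t = integral_operator k z t"
          using set_integral_diff(2)[OF kernel_times_BV_integrable[OF h y]
              kernel_times_BV_integrable[OF h x]]
          by (simp add: integral_operator_def z_def right_diff_distrib)
      qed
      moreover have "\<bar>integral_operator k z 0\<bar> \<le> C * norm_BV z"
        unfolding integral_operator_def C_def
        by (rule kernel_times_BV_integral_bound[OF integrable z]) simp
      moreover have "C * norm_BV z \<le> C * r" using C r by (intro mult_left_mono) auto
      moreover have "schramm_var \<phi> (\<lambda>t. (\<mu> / (2 * r)) * integral_operator k z t) \<le> 1"
        by (rule var_le[OF _ _ z]) (use r in auto)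
      \<comment> \<open>The factor \<open>\<mu> / (2 * r)\<close> is the inverse of
        \<open>2 * r / \<mu>\<close>, which therefore competes in the infimum.\<close>
      then have "seminorm_Phi \<phi> (integral_operator k z) \<le> 2 * r / \<mu>"
        by (intro seminorm_Phi_le) (use r \<mu> in auto)
      moreover have "C * r + 2 * r / \<mu> = (C + 2 / \<mu>) * r" by (simp add: algebra_simps)
      moreover have "(C + 2 / \<mu>) * r < (C + 2 / \<mu>) * \<delta>" using den r by simp
      moreover have "(C + 2 / \<mu>) * \<delta> = \<epsilon>" using den by (simp add: \<delta>_def)
      ultimately show "norm_Phi \<phi> (\<lambda>t. integral_operator k y t - integral_operator k x t) < \<epsilon>"
        unfolding norm_Phi_def by linarith
    qed
  qed
  ultimately show "?maps \<and> ?cont" ..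
qed

end
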